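(* For every integer $n\ge 1$, $$|AI_{n}(1234)|=|RAI_{n}(4321)|\quad\text{and}\quad |RAI_{n}(1234)|=|AI_{n}(4321)|.$$
   Context: Let $S_n$ be the set of permutations $\pi=\pi_1\ldots\pi_n$ of $\{1,\ldots,n\}$. A permutation is alternating if, for all $1\le i\le n-1$, $\pi_i<\pi_{i+1}$ if and only if $i$ is odd; it is reverse alternating if, for all $1\le i\le n-1$, $\pi_i>\pi_{i+1}$ if and only if $i$ is odd. $AI_n$ (resp. $RAI_n$) is the set of alternating (resp. reverse alternating) involutions ($\pi=\pi^{-1}$) in $S_n$. A permutation $\pi\in S_n$ avoids the pattern $\tau\in S_k$ if there are no indices $i_1<\cdots<i_k$ such that $\pi_{i_1}\ldots\pi_{i_k}$ is order-isomorphic to $\tau$; $AI_n(\tau)$ and $RAI_n(\tau)$ are the subsets of elements avoiding $\tau$. *)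

theory Defs
  imports "HOL-Combinatorics.Permutations"
begin

text \<open>
  An element of \<open>S_n\<close> is a function \<open>p :: nat \<Rightarrow> nat\<close> with \<open>p permutes {1..n}\<close>;
  since such a function is the identity outside \<open>{1..n}\<close>, these functions correspond
  bijectively to the permutations of \<open>{1..n}\<close>. The one-line notation of \<open>p\<close> is \<open>p 1 \<dots> p n\<close>.
\<close>

definition alternating :: "nat \<Rightarrow> (nat \<Rightarrow> nat) \<Rightarrow> bool" where
  "alternating n p \<longleftrightarrow> (\<forall>i\<in>{1..<n}. p i < p (i + 1) \<longleftrightarrow> odd i)"

definition reverse_alternating :: "nat \<Rightarrow> (nat \<Rightarrow> nat) \<Rightarrow> bool" where
  "reverse_alternating n p \<longleftrightarrow> (\<forall>i\<in>{1..<n}. p i > p (i + 1) \<longleftrightarrow> odd i)"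

text \<open>
  A pattern is given by its one-line notation, a list \<open>\<tau>\<close>. List positions start at 0, so the
  index sequence \<open>i_1 < \<dots> < i_k\<close> of an occurrence is \<open>idx 0 < \<dots> < idx (k - 1)\<close>.
\<close>

definition contains_pattern :: "nat \<Rightarrow> (nat \<Rightarrow> nat) \<Rightarrow> nat list \<Rightarrow> bool" where
  "contains_pattern n p \<tau> \<longleftrightarrow>
     (\<exists>idx :: nat \<Rightarrow> nat.
        strict_mono_on {..<length \<tau>} idx \<and>
        idx ` {..<length \<tau>} \<subseteq> {1..n} \<and>
        (\<forall>a<length \<tau>. \<forall>b<length \<tau>. p (idx a) < p (idx b) \<longleftrightarrow> \<tau> ! a < \<tau> ! b))"

definition avoids :: "nat \<Rightarrow> (nat \<Rightarrow> nat) \<Rightarrow> nat list \<Rightarrow> bool" where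
  "avoids n p \<tau> \<longleftrightarrow> \<not> contains_pattern n p \<tau>"

definition AI :: "nat \<Rightarrow> (nat \<Rightarrow> nat) set" where
  "AI n = {p. p permutes {1..n} \<and> p = inv p \<and> alternating n p}"

definition RAI :: "nat \<Rightarrow> (nat \<Rightarrow> nat) set" where
  "RAI n = {p. p permutes {1..n} \<and> p = inv p \<and> reverse_alternating n p}"

definition AI_avoiding :: "nat \<Rightarrow> nat list \<Rightarrow> (nat \<Rightarrow> nat) set" where
  "AI_avoiding n \<tau> = {p \<in> AI n. avoids n p \<tau>}"

definition RAI_avoiding :: "nat \<Rightarrow> nat list \<Rightarrow> (nat \<Rightarrow> nat) set" where
  "RAI_avoiding n \<tau> = {p \<in> RAI n. avoids n p \<tau>}"

end

theory Submission
  imports Defs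
begin

text \<open>
  The Robinson--Schensted correspondence maps involutions bijectively to standard Young tableaux. It
  preserves descents, and longest increasing and decreasing subsequences become the numbers of columns
  and rows. Transposing the tableau complements the descent set and exchanges rows and columns, so it
  exchanges alternating involutions avoiding 1234 with reverse alternating ones avoiding 4321, and
  likewise with the two kinds of alternation swapped.

  The correspondence is obtained from Viennot's shadow construction. An involution is a symmetric set
  of points; the corners of its shadow lines form a smaller symmetric partial permutation, and the
  columns that contain a point but no corner are the entries of the first row of the tableau.
  Iterating this gives the rows one by one. Tableaux are encoded by lattice words, which list for each \<open>i\<close>
  the row that contains \<open>i\<close>.
\<close>

section \<open>Shadows of partial involutions\<close>

text \<open>A relation rather than a function, because shadows drop columns. \<open>X i j\<close> is
  read as a point in column \<open>i\<close> and row \<open>j\<close> of a grid, at most one in each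
  column and row.\<close>

definition partial_involution :: "nat \<Rightarrow> (nat \<Rightarrow> nat \<Rightarrow> bool) \<Rightarrow> bool" where
  "partial_involution n X \<longleftrightarrow>
     (\<forall>i j. X i j \<longrightarrow> X j i) \<and> (\<forall>i j k. X i j \<longrightarrow> X i k \<longrightarrow> j = k) \<and> (\<forall>i j. X i j \<longrightarrow> i < n)"

definition support :: "(nat \<Rightarrow> nat \<Rightarrow> bool) \<Rightarrow> nat set" where
  "support X = {i. \<exists>j. X i j}"

text \<open>
  For partial involutions, \<open>rank X i j\<close> is the length of a longest increasing chain of points of
  \<open>X\<close> in \<open>{..<i} \<times> {..<j}\<close>.
\<close>

fun rank :: "(nat \<Rightarrow> nat \<Rightarrow> bool) \<Rightarrow> nat \<Rightarrow> nat \<Rightarrow> nat" where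
  "rank X 0 j = 0"
| "rank X (Suc i) 0 = 0"
| "rank X (Suc i) (Suc j) =
     (if X i j then Suc (rank X i j) else max (rank X (Suc i) j) (rank X i (Suc j)))"

text \<open>
  The corners of Viennot's shadow lines of \<open>X\<close>. In terms of Fomin's growth diagrams, they are the
  cells from which the insertion passes on to the next row of the tableau.
\<close>

definition shadow :: "(nat \<Rightarrow> nat \<Rightarrow> bool) \<Rightarrow> nat \<Rightarrow> nat \<Rightarrow> bool" where
  "shadow X i j \<longleftrightarrow> \<not> X i j \<and> rank X i j < rank X (Suc i) j \<and> rank X i j < rank X i (Suc j)"

text \<open>
  \<open>live X i j\<close>: the shadow line that starts in column \<open>i\<close> at the point of \<open>X\<close> is still running
  vertically when it enters row \<open>j\<close>; a corner turns it away.
\<close>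

definition live :: "(nat \<Rightarrow> nat \<Rightarrow> bool) \<Rightarrow> nat \<Rightarrow> nat \<Rightarrow> bool" where
  "live X i j \<longleftrightarrow> (\<exists>k<j. X i k) \<and> \<not> (\<exists>k<j. shadow X i k)"

lemma partial_involutionD:
  assumes "partial_involution n X"
  shows partial_involution_sym: "X i j \<Longrightarrow> X j i"
    and partial_involution_unique: "X i j \<Longrightarrow> X i k \<Longrightarrow> j = k"
    and partial_involution_less: "X i j \<Longrightarrow> i < n"
    and partial_involution_less': "X i j \<Longrightarrow> j < n"
  using assms unfolding partial_involution_def by blast+

lemma rank_0_right [simp]: "rank X i 0 = 0"
  by (cases i) auto

lemma rank_commute:
  assumes "partial_involution n X"
  shows "rank X i j = rank X j i"
proof -
  have "X i j \<longleftrightarrow> X j i" for i j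
    using partial_involution_sym[OF assms] by blast
  then show ?thesis
    by (induction X i j rule: rank.induct) (auto simp: max.commute)
qed

text \<open>The local rule of a growth diagram: an edge of the grid raises the rank exactly when a
  shadow line crosses it. In each cell a point starts a line upwards and to the right, two lines
  that meet turn each other off in a corner, and a single line passes straight through.\<close>

lemma rank_step:
  assumes X: "partial_involution n X"
  shows "rank X (Suc i) j = rank X i j + of_bool (live X i j)"
proof (induction "i + j" arbitrary: i j rule: less_induct)
  case less
  show ?case
  proof (cases j)
    case 0
    then show ?thesis by (simp add: live_def)
  next
    case (Suc m)
    have e: "rank X (Suc i) k = rank X i k + of_bool (live X i k)" if "k \<le> m" for k
      using less.hyps[of i k] that Suc by simp
    have f: "rank X i (Suc m) = rank X i m + of_bool (live X m i)"
      using less.hyps[of m i] Suc rank_commute[OF X] by simp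
    show ?thesis
    proof (cases "X i m")
      case True
      \<comment> \<open>Column and row of the point are empty before it, so no line enters the cell
        and no corner lies earlier in column \<open>i\<close>.\<close>
      have none: "\<not> (\<exists>k<m. X i k)" "\<not> (\<exists>k<i. X m k)"
        using partial_involution_unique[OF X True] partial_involution_sym[OF X True]
          partial_involution_unique[OF X, of m i] by blast+
      then have "\<not> live X m i" by (auto simp: live_def)
      moreover have "\<not> shadow X i k" if "k \<le> m" for k
        using e[OF that] none that by (auto simp: shadow_def live_def)
      then have "live X i (Suc m)"
        using True by (auto simp: live_def less_Suc_eq_le)
      ultimately show ?thesis using True f Suc by simp
    next
      case False
      have sh: "shadow X i m \<longleftrightarrow> live X i m \<and> live X m i"
        using False e[of m] f by (auto simp: shadow_def)
      have "live X i (Suc m) \<longleftrightarrow> live X i m \<and> \<not> live X m i"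
        using False sh by (auto simp: live_def less_Suc_eq)
      then show ?thesis using False e[of m] f Suc by auto
    qed
  qed
qed

lemma rank_step':
  assumes "partial_involution n X"
  shows "rank X i (Suc j) = rank X i j + of_bool (live X j i)"
  using rank_step[OF assms, of j i] rank_commute[OF assms] by simp

lemma rank_mono:
  assumes "partial_involution n X" and "i \<le> i'" and "j \<le> j'"
  shows "rank X i j \<le> rank X i' j'"
proof -
  have "rank X i j \<le> rank X i' j"
    by (rule lift_Suc_mono_le[of "\<lambda>i. rank X i j"]) (use assms rank_step[OF assms(1)] in auto)
  also have "\<dots> \<le> rank X i' j'"
    by (rule lift_Suc_mono_le[of "rank X i'"]) (use assms rank_step'[OF assms(1)] in auto)
  finally show ?thesis .
qed

lemma not_live:
  assumes "partial_involution n X" and "X i j"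
  shows "\<not> live X i j"
  using partial_involution_unique[OF assms(1,2)] by (auto simp: live_def)

lemma shadow_iff_live:
  assumes "partial_involution n X"
  shows "shadow X i j \<longleftrightarrow> live X i j \<and> live X j i"
  using rank_step[OF assms, of i j] rank_step'[OF assms, of i j] not_live[OF assms]
  by (auto simp: shadow_def)

lemma shadowE:
  assumes "partial_involution n X" and "shadow X i j"
  obtains k where "k < j" "X i k"
  using assms(2) unfolding shadow_iff_live[OF assms(1)] by (auto simp: live_def)

lemma partial_involution_shadow:
  assumes "partial_involution n X"
  shows "partial_involution n (shadow X)"
proof -
  have "shadow X j i" if "shadow X i j" for i j
    using that by (simp add: shadow_iff_live[OF assms])
  moreover have "i < n" if "shadow X i j" for i j
    using shadowE[OF assms that] partial_involution_less[OF assms] by metis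
  \<comment> \<open>A corner ends its line, so no later corner can lie in the same column.\<close>
  moreover have "\<not> j < k" if "shadow X i j" "shadow X i k" for i j k
    using that(1) that(2)[unfolded shadow_iff_live[OF assms]] by (auto simp: live_def)
  then have "j = k" if "shadow X i j" "shadow X i k" for i j k
    using that by (meson linorder_neqE_nat)
  ultimately show ?thesis unfolding partial_involution_def by blast
qed

lemma support_shadow_subset:
  assumes "partial_involution n X"
  shows "support (shadow X) \<subseteq> support X"
  unfolding support_def using shadowE[OF assms] by blast

text \<open>A corner lies strictly beyond the point that starts its line, so the smallest possible
  column is lost. This makes the iteration of shadows die out.\<close>

lemma support_shadow_greater:
  assumes "partial_involution n X" and "support X \<subseteq> {m..}"
  shows "support (shadow X) \<subseteq> {Suc m..}"
proof
  fix i assume "i \<in> support (shadow X)"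
  then obtain j where "shadow X j i"
    using partial_involution_sym[OF partial_involution_shadow[OF assms(1)]]
    unfolding support_def by blast
  then obtain k where "k < i" "X j k" using shadowE[OF assms(1)] by blast
  moreover from this have "k \<in> support X"
    using partial_involution_sym[OF assms(1)] unfolding support_def by blast
  ultimately show "i \<in> {Suc m..}" using assms(2) by auto
qed

text \<open>The lines that leave the grid at the top have a starting point but no corner: their
  columns form the first row of the tableau.\<close>

lemma live_margin:
  assumes "partial_involution n X"
  shows "live X i n \<longleftrightarrow> i \<in> support X - support (shadow X)"
  using partial_involution_less'[OF assms]
    partial_involution_less'[OF partial_involution_shadow[OF assms]]
  unfolding live_def support_def by blast

lemma card_lessThan_Suc_Int:
  fixes i :: nat
  shows "card (U \<inter> {..<Suc i}) = card (U \<inter> {..<i}) + of_bool (i \<in> U)"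
  by (auto simp: lessThan_Suc)

lemma rank_margin:
  assumes "partial_involution n X"
  shows "rank X i n = card ((support X - support (shadow X)) \<inter> {..<i})"
  by (induction i)
     (simp_all add: rank_step[OF assms] live_margin[OF assms] card_lessThan_Suc_Int
       del: Diff_iff)

text \<open>This becomes the lattice condition on consecutive rows. A corner in the cell
  \<open>(i, j)\<close> adds one to the rank of the shadow, but there the rank of \<open>X\<close>
  rises already from \<open>i\<close> to \<open>Suc i\<close>.\<close>

lemma rank_shadow_le:
  assumes X: "partial_involution n X"
  shows "rank (shadow X) i j \<le> rank X i j"
proof (induction "shadow X" i j rule: rank.induct)
  case (3 i j)
  show ?case
  proof (cases "shadow X i j")
    case True
    then have "rank X i j < rank X (Suc i) j" by (simp add: shadow_def)
    also have "\<dots> \<le> rank X (Suc i) (Suc j)" by (intro rank_mono[OF X]) auto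
    finally show ?thesis using 3(1) True by simp
  next
    case False
    have "rank X (Suc i) j \<le> rank X (Suc i) (Suc j)" "rank X i (Suc j) \<le> rank X (Suc i) (Suc j)"
      by (intro rank_mono[OF X]; simp)+
    then show ?thesis using 3(2,3)[OF False] False by auto
  qed
qed auto

text \<open>
  The right-hand side does not mention \<open>X\<close> itself, so the ranks can be computed downwards from the
  margins and the shadow.
\<close>

lemma rank_backward:
  assumes X: "partial_involution n X"
  shows "rank X i j =
    (if shadow X i j then rank X (Suc i) j - 1 else min (rank X (Suc i) j) (rank X i (Suc j)))"
  unfolding shadow_iff_live[OF X]
  by (simp add: rank_step[OF X, of i j] rank_step'[OF X, of i j])

text \<open>Recovers the points from the ranks: only a point makes both far edges of its cell
  live.\<close>

lemma rank_increase_iff: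
  assumes X: "partial_involution n X"
  shows "X i j \<longleftrightarrow> max (rank X (Suc i) j) (rank X i (Suc j)) < rank X (Suc i) (Suc j)"
  using rank_step[OF X, of i j] rank_step'[OF X, of i j] not_live[OF X, of i j]
    not_live[OF X, of j i] partial_involution_sym[OF X, of i j]
  by (cases "X i j") auto

text \<open>Injectivity of one step: support and shadow determine the first row, hence the ranks on
  the margins; \<open>rank_backward\<close> then fills the square and
  \<open>rank_increase_iff\<close> reads off the points.\<close>

lemma partial_involution_eqI:
  assumes X: "partial_involution n X" and X': "partial_involution n X'"
    and supp: "support X = support X'" and sh: "shadow X = shadow X'"
  shows "X = X'"
proof -
  have margin: "rank X i n = rank X' i n" for i
    using rank_margin[OF X] rank_margin[OF X'] supp sh by simp
  have eq: "rank X i j = rank X' i j" if "i \<le> n" "j \<le> n" for i j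
    using that
  proof (induction "(n - i) + (n - j)" arbitrary: i j rule: less_induct)
    case less
    show ?case
    proof (cases "i = n \<or> j = n")
      case True
      then show ?thesis using margin rank_commute[OF X] rank_commute[OF X'] by metis
    next
      case False
      then have "rank X (Suc i) j = rank X' (Suc i) j" "rank X i (Suc j) = rank X' i (Suc j)"
        using less by auto
      then show ?thesis using rank_backward[OF X, of i j] rank_backward[OF X', of i j] sh by simp
    qed
  qed
  show ?thesis
  proof (intro ext)
    fix i j
    show "X i j = X' i j"
    proof (cases "i < n \<and> j < n")
      case True
      then show ?thesis
        using eq[of "Suc i" j] eq[of i "Suc j"] eq[of "Suc i" "Suc j"]
        unfolding rank_increase_iff[OF X, of i j] rank_increase_iff[OF X', of i j] by simp
    next
      case False
      then have "\<not> X i j" "\<not> X' i j"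
        using partial_involution_less[OF X, of i j] partial_involution_less'[OF X, of i j]
          partial_involution_less[OF X', of i j] partial_involution_less'[OF X', of i j] by auto
      then show ?thesis by simp
    qed
  qed
qed

section \<open>Recovering a partial involution from its shadow\<close>

text \<open>\<open>rank_backward\<close> turned into a recursion from the far margins, where
  \<open>g\<close> supplies the values; \<open>Y\<close> is the prescribed shadow. At a corner the
  two neighbouring ranks agree, so lowering their minimum by one is the same rule.\<close>

function unrank :: "(nat \<Rightarrow> nat \<Rightarrow> bool) \<Rightarrow> (nat \<Rightarrow> nat) \<Rightarrow> nat \<Rightarrow> nat \<Rightarrow> nat \<Rightarrow> nat" where
  "unrank Y g n i j =
     (if n \<le> i then g j else if n \<le> j then g i
      else min (unrank Y g n (Suc i) j) (unrank Y g n i (Suc j)) - of_bool (Y i j))"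
  by pat_completeness auto
termination
  by (relation "Wellfounded.measure (\<lambda>(Y, g, n, i, j). (n - i) + (n - j))") auto

declare unrank.simps [simp del]

lemma ex_ge_Suc: "(\<exists>k\<ge>m. P k) \<longleftrightarrow> P m \<or> (\<exists>k\<ge>Suc m. P k)" for m :: nat
proof -
  have "m \<le> k \<longleftrightarrow> k = m \<or> Suc m \<le> k" for k by auto
  then show ?thesis by (simp add: ex_disj_distrib conj_disj_distribR)
qed

text \<open>
  \<open>U\<close> is the prescribed first row. The last assumption is the condition that the columns of the
  tableau increase; it keeps the truncated subtraction in \<open>unrank\<close> harmless.
\<close>

locale unshadow =
  fixes n :: nat and Y :: "nat \<Rightarrow> nat \<Rightarrow> bool" and U :: "nat set"
  assumes Y: "partial_involution n Y"
    and U_less: "U \<subseteq> {..<n}"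
    and U_disjoint: "U \<inter> support Y = {}"
    and U_dominates: "rank Y i n \<le> card (U \<inter> {..<i})"
begin

definition R :: "nat \<Rightarrow> nat \<Rightarrow> nat" where
  "R = unrank Y (\<lambda>i. card (U \<inter> {..<i})) n"

definition X :: "nat \<Rightarrow> nat \<Rightarrow> bool" where
  "X i j \<longleftrightarrow> i < n \<and> j < n \<and> R (Suc i) j < R (Suc i) (Suc j) \<and> R i (Suc j) < R (Suc i) (Suc j)"

text \<open>The mirror image of \<open>live\<close>, read from the top margin downwards.\<close>

definition pending :: "nat \<Rightarrow> nat \<Rightarrow> bool" where
  "pending i j \<longleftrightarrow> (i \<in> U \<or> (\<exists>k\<ge>j. Y i k)) \<and> \<not> (\<exists>k\<ge>j. X i k)"

lemma R_margin: "j \<le> n \<Longrightarrow> R n j = card (U \<inter> {..<j})" "i \<le> n \<Longrightarrow> R i n = card (U \<inter> {..<i})"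
  unfolding R_def by (subst unrank.simps; auto)+

lemma R_rec:
  assumes "i < n" "j < n"
  shows "R i j = min (R (Suc i) j) (R i (Suc j)) - of_bool (Y i j)"
  unfolding R_def using assms by (subst unrank.simps) auto

lemma R_commute: "i \<le> n \<Longrightarrow> j \<le> n \<Longrightarrow> R i j = R j i"
proof (induction "(n - i) + (n - j)" arbitrary: i j rule: less_induct)
  case less
  show ?case
  proof (cases "i < n \<and> j < n")
    case True
    then have "R (Suc i) j = R j (Suc i)" "R i (Suc j) = R (Suc j) i"
      using less.hyps by auto
    moreover have "Y i j \<longleftrightarrow> Y j i" using partial_involution_sym[OF Y] by blast
    ultimately show ?thesis using True R_rec[of i j] R_rec[of j i] by (simp add: min.commute)
  next
    case False
    then have "i = n \<or> j = n" using less.prems by linarith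
    then show ?thesis using less.prems R_margin by auto
  qed
qed

lemma X_commute: "X i j \<longleftrightarrow> X j i"
  using R_commute[of "Suc i" j] R_commute[of i "Suc j"] R_commute[of "Suc i" "Suc j"]
  by (auto simp: X_def)

text \<open>The inverse local rule, by induction from the top right corner of the square. The claims
  are proved together: the edge claims tell how lines cross a cell, and the lower bound by
  \<open>rank Y\<close> makes the subtraction at a corner a true one.\<close>

lemma R_step_aux:
  assumes "i \<le> n" "j \<le> n"
  shows "rank Y i j \<le> R i j \<and> (i < n \<longrightarrow> R (Suc i) j = R i j + of_bool (pending i j))
    \<and> (j < n \<longrightarrow> R i (Suc j) = R i j + of_bool (pending j i))"
  using assms
proof (induction "(n - i) + (n - j)" arbitrary: i j rule: less_induct)
  case less
  have noYX: "\<not> Y k l" "\<not> X k l" if "n \<le> l" for k l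
    using that partial_involution_less'[OF Y, of k l] by (auto simp: X_def)
  consider "i = n" | "j = n" | "i < n" "j < n" using less.prems by linarith
  then show ?case
  proof cases
    case 1
    have "pending j i \<longleftrightarrow> j \<in> U" using noYX 1 by (auto simp: pending_def)
    then show ?thesis
      using 1 less.prems U_dominates rank_commute[OF Y]
      by (auto simp: R_margin card_lessThan_Suc_Int simp del: of_bool_eq_iff)
  next
    case 2
    have "pending i j \<longleftrightarrow> i \<in> U" using noYX 2 by (auto simp: pending_def)
    then show ?thesis
      using 2 less.prems U_dominates
      by (auto simp: R_margin card_lessThan_Suc_Int)
  next
    case 3
    have IH: "rank Y i' j' \<le> R i' j'"
      "i' < n \<Longrightarrow> R (Suc i') j' = R i' j' + of_bool (pending i' j')"
      "j' < n \<Longrightarrow> R i' (Suc j') = R i' j' + of_bool (pending j' i')"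
      if "i \<le> i'" "j \<le> j'" "i' \<le> n" "j' \<le> n" "(i', j') \<noteq> (i, j)" for i' j'
    proof -
      have "(n - i') + (n - j') < (n - i) + (n - j)"
        using that 3 by (cases "i' = i") auto
      then show "rank Y i' j' \<le> R i' j'"
        "i' < n \<Longrightarrow> R (Suc i') j' = R i' j' + of_bool (pending i' j')"
        "j' < n \<Longrightarrow> R i' (Suc j') = R i' j' + of_bool (pending j' i')"
        using less.hyps[of i' j'] that by simp_all
    qed
    have c: "R (Suc i) (Suc j) = R i (Suc j) + of_bool (pending i (Suc j))"
      using IH(2)[of i "Suc j"] 3 by auto
    have b: "R (Suc i) (Suc j) = R (Suc i) j + of_bool (pending j (Suc i))"
      using IH(3)[of "Suc i" j] 3 by auto
    have Xij: "X i j \<longleftrightarrow> pending i (Suc j) \<and> pending j (Suc i)"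
      using b c 3 by (auto simp: X_def of_bool_def split: if_splits)
    have Xpi: "pending i (Suc k)" if "X i k" "j \<le> k" for k
      using that IH(2)[of i "Suc k"] by (auto simp: X_def of_bool_def split: if_splits)
    have Xpj: "pending j (Suc k)" if "X k j" "i \<le> k" for k
      using that IH(3)[of "Suc k" j] by (auto simp: X_def of_bool_def split: if_splits)
    show ?thesis
    proof (cases "Y i j")
      case True
      then have Y1: "\<not> Y i k" if "k \<noteq> j" for k
        using that partial_involution_unique[OF Y] by blast
      have Y2: "\<not> Y j k" if "k \<noteq> i" for k
        using that True partial_involution_unique[OF Y] partial_involution_sym[OF Y] by blast
      have "i \<notin> U" "j \<notin> U"
        using True U_disjoint partial_involution_sym[OF Y True] by (auto simp: support_def)
      \<comment> \<open>Beyond the corner, its column and row hold no further point of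
        \<open>Y\<close> and they are not in \<open>U\<close>, so both far edges are
        unmarked.\<close>
      then have np: "\<And>k. j < k \<Longrightarrow> \<not> pending i k" "\<And>k. i < k \<Longrightarrow> \<not> pending j k"
        using Y1 Y2 by (auto simp: pending_def)
      then have bc: "R (Suc i) j = R (Suc i) (Suc j)" "R i (Suc j) = R (Suc i) (Suc j)"
        using b c np(1)[of "Suc j"] np(2)[of "Suc i"] by auto
      have "rank Y (Suc i) (Suc j) \<le> R (Suc i) (Suc j)" using IH(1)[of "Suc i" "Suc j"] 3 by auto
      \<comment> \<open>\<open>rank Y\<close> at the far vertex counts the corner itself, so there
        is something to subtract from.\<close>
      then have pos: "Suc (rank Y i j) \<le> R (Suc i) (Suc j)" using True by simp
      have "\<not> X i k" if "k \<ge> j" for k using Xpi[OF _ that] np(1)[of "Suc k"] that by auto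
      moreover have "\<not> X j k" if "k \<ge> i" for k
        using Xpj[OF _ that] X_commute[of j k] np(2)[of "Suc k"] that by auto
      ultimately have "pending i j" "pending j i"
        using True partial_involution_sym[OF Y True] by (auto simp: pending_def)
      then show ?thesis using bc pos R_rec[OF 3] True by auto
    next
      case False
      have YF: "\<not> Y j i" using False partial_involution_sym[OF Y] by blast
      have p1: "pending i j \<longleftrightarrow> pending i (Suc j) \<and> \<not> X i j"
        using False ex_ge_Suc[of j "X i"] ex_ge_Suc[of j "Y i"] unfolding pending_def by blast
      have p2: "pending j i \<longleftrightarrow> pending j (Suc i) \<and> \<not> X i j"
        using YF X_commute[of j i] ex_ge_Suc[of i "X j"] ex_ge_Suc[of i "Y j"]
        unfolding pending_def by blast
      have "rank Y i j \<le> rank Y (Suc i) j" "rank Y i j \<le> rank Y i (Suc j)"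
        by (intro rank_mono[OF Y]; simp)+
      then have "rank Y i j \<le> R i j"
        using IH(1)[of "Suc i" j] IH(1)[of i "Suc j"] R_rec[OF 3] False 3 by auto
      then show ?thesis using p1 p2 Xij b c R_rec[OF 3] False by auto
    qed
  qed
qed

lemma
  assumes "i < n" "j \<le> n"
  shows R_step: "R (Suc i) j = R i j + of_bool (pending i j)"
    and R_step': "R j (Suc i) = R j i + of_bool (pending i j)"
  using R_step_aux[of i j] R_step_aux[of j i] assms by auto

text \<open>Along this margin the values grow up to \<open>R 0 n\<close>, which counts an empty part
  of \<open>U\<close>.\<close>

lemma R_0: "j \<le> n \<Longrightarrow> R 0 j = 0"
proof -
  assume "j \<le> n"
  then have "R 0 j \<le> R 0 n"
    by (induction rule: inc_induct) (auto simp: R_step')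
  then show ?thesis by (simp add: R_margin)
qed

lemma X_pending: "X i k \<Longrightarrow> pending i (Suc k)"
  using R_step[of i "Suc k"] by (auto simp: X_def of_bool_def split: if_splits)

lemma Y_not_pending:
  assumes "Y i j" "j < k"
  shows "\<not> pending i k"
proof -
  have "\<not> Y i l" if "k \<le> l" for l
    using partial_involution_unique[OF Y assms(1), of l] assms(2) that by (metis leD)
  moreover have "i \<notin> U" using assms(1) U_disjoint by (auto simp: support_def)
  ultimately show ?thesis by (simp add: pending_def)
qed

lemma Y_pending:
  assumes "Y i j"
  shows "pending i j"
proof -
  have "\<not> X i k" if "j \<le> k" for k
    using X_pending[of i k] Y_not_pending[OF assms, of "Suc k"] that by auto
  then show ?thesis using assms by (auto simp: pending_def)
qed

lemma partial_involution_X: "partial_involution n X"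
  unfolding partial_involution_def
proof (intro conjI allI impI)
  fix i j k
  show "X j i" if "X i j" using that X_commute by blast
  show "i < n" if "X i j" using that by (simp add: X_def)
  show "j = k" if "X i j" "X i k"
    using that X_pending[of i j] X_pending[of i k] unfolding pending_def
    by (cases j k rule: linorder_cases) (auto simp: Suc_le_eq)
qed

text \<open>On the square \<open>R\<close> obeys the recursion of \<open>rank\<close> for the points
  of \<open>X\<close>, with zero margins by \<open>R_0\<close>; so the values computed downwards are
  genuine ranks.\<close>

lemma rank_X: "i \<le> n \<Longrightarrow> j \<le> n \<Longrightarrow> rank X i j = R i j"
proof (induction X i j rule: rank.induct)
  case (2 i)
  then show ?case using R_0[of "Suc i"] R_commute[of 0 "Suc i"] by simp
next
  case (3 i j)
  show ?case
  proof (cases "X i j")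
    case True
    then have "pending i (Suc j)" "\<not> pending j i"
      using X_pending[of i j] X_commute[of i j] by (auto simp: pending_def)
    then show ?thesis
      using True 3 R_step[of i "Suc j"] R_step'[of j i] by simp
  next
    case False
    then show ?thesis
      using 3 R_step[of i "Suc j"] R_step'[of j "Suc i"] by (auto simp: X_def)
  qed
qed (simp add: R_0)

lemma shadow_X: "shadow X = Y"
proof (intro ext)
  fix i j
  show "shadow X i j = Y i j"
  proof (cases "i < n \<and> j < n")
    case True
    then have rank: "rank X i j = R i j" "rank X (Suc i) j = R (Suc i) j" "rank X i (Suc j) = R i (Suc j)"
      by (simp_all add: rank_X)
    show ?thesis
    proof (cases "Y i j")
      assume Yij: "Y i j"
      then have "\<not> X i j"
        using R_step[of i "Suc j"] True Y_not_pending[OF Yij, of "Suc j"] by (auto simp: X_def)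
      moreover have "pending i j" "pending j i"
        using True Yij Y_pending partial_involution_sym[OF Y] by blast+
      ultimately show ?thesis
        using Yij True R_step[of i j] R_step'[of j i] unfolding shadow_def rank by simp
    next
      assume "\<not> Y i j"
      then show ?thesis using True R_rec[of i j] unfolding shadow_def rank by auto
    qed
  next
    case False
    then have "\<not> Y i j" "\<not> shadow X i j"
      using partial_involution_less[OF Y, of i j] partial_involution_less'[OF Y, of i j]
        partial_involution_less[OF partial_involution_shadow[OF partial_involution_X], of i j]
        partial_involution_less'[OF partial_involution_shadow[OF partial_involution_X], of i j]
      by auto
    then show ?thesis by simp
  qed
qed

lemma support_X: "support X = U \<union> support Y"
proof (intro set_eqI)
  fix i
  show "i \<in> support X \<longleftrightarrow> i \<in> U \<union> support Y"
  proof (cases "i < n")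
    case True
    \<comment> \<open>Every line that came from \<open>U\<close> or from a corner has ended in a
      point before reaching the bottom margin.\<close>
    then have "\<not> pending i 0"
      using R_step'[of i 0] R_0[of "Suc i"] by simp
    moreover have "i \<in> U \<union> support Y" if "X i k" for k
      using X_pending[OF that] by (auto simp: pending_def support_def)
    ultimately show ?thesis by (auto simp: pending_def support_def)
  next
    case False
    then show ?thesis
      using U_less partial_involution_less[OF Y] partial_involution_less[OF partial_involution_X]
      by (auto simp: support_def)
  qed
qed

end

lemma partial_involution_exists:
  assumes "partial_involution n Y" and "U \<subseteq> {..<n}" and "U \<inter> support Y = {}"
    and "\<And>i. rank Y i n \<le> card (U \<inter> {..<i})"
  obtains X where "partial_involution n X" and "support X = U \<union> support Y" and "shadow X = Y"
proof -
  interpret unshadow n Y U using assms by unfold_locales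
  show ?thesis using that partial_involution_X support_X shadow_X .
qed

section \<open>Chains and descents\<close>

definition inc_chain :: "(nat \<Rightarrow> nat \<Rightarrow> bool) \<Rightarrow> nat \<Rightarrow> (nat \<Rightarrow> nat) \<Rightarrow> (nat \<Rightarrow> nat) \<Rightarrow> bool" where
  "inc_chain X k p q \<longleftrightarrow>
     (\<forall>a<k. X (p a) (q a)) \<and> (\<forall>b<k. \<forall>a<b. p a < p b \<and> q a < q b)"

definition dec_chain :: "(nat \<Rightarrow> nat \<Rightarrow> bool) \<Rightarrow> nat \<Rightarrow> (nat \<Rightarrow> nat) \<Rightarrow> (nat \<Rightarrow> nat) \<Rightarrow> bool" where
  "dec_chain X k p q \<longleftrightarrow>
     (\<forall>a<k. X (p a) (q a)) \<and> (\<forall>b<k. \<forall>a<b. p a < p b \<and> q b < q a)"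

section \<open>Increasing chains and the rank\<close>

lemma inc_chain_upto_rank:
  "k \<le> rank X i j \<Longrightarrow> \<exists>p q. inc_chain X k p q \<and> (\<forall>a<k. p a < i \<and> q a < j)"
proof (induction X i j arbitrary: k rule: rank.induct)
  case (3 X i j)
  show ?case
  proof (cases "X i j")
    case True
    show ?thesis
    proof (cases k)
      case 0
      then show ?thesis by (simp add: inc_chain_def)
    next
      case (Suc m)
      then have "m \<le> rank X i j" using 3(4) True by simp
      then obtain p q where pq: "inc_chain X m p q" "\<forall>a<m. p a < i \<and> q a < j"
        using 3(1)[OF True] by blast
      have "inc_chain X k (p(m := i)) (q(m := j)) \<and>
          (\<forall>a<k. (p(m := i)) a < Suc i \<and> (q(m := j)) a < Suc j)"
        using pq True Suc by (auto simp: inc_chain_def less_Suc_eq)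
      then show ?thesis by blast
    qed
  next
    case False
    then consider "k \<le> rank X (Suc i) j" | "k \<le> rank X i (Suc j)"
      using 3(4) by (auto simp: max_def split: if_splits)
    then show ?thesis
    proof cases
      case 1
      from 3(2)[OF False this] show ?thesis using less_Suc_eq by blast
    next
      case 2
      from 3(3)[OF False this] show ?thesis using less_Suc_eq by blast
    qed
  qed
qed (auto simp: inc_chain_def)

lemma inc_chain_length_le_rank:
  assumes X: "partial_involution n X"
  shows "inc_chain X k p q \<Longrightarrow> \<forall>a<k. p a < i \<and> q a < j \<Longrightarrow> k \<le> rank X i j"
proof (induction k arbitrary: i j)
  case (Suc k)
  have "k \<le> rank X (p k) (q k)"
    using Suc.prems by (intro Suc.IH) (auto simp: inc_chain_def)
  moreover have "X (p k) (q k)" using Suc.prems by (auto simp: inc_chain_def)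
  ultimately have "Suc k \<le> rank X (Suc (p k)) (Suc (q k))" by simp
  also have "\<dots> \<le> rank X i j"
    using Suc.prems by (intro rank_mono[OF X]) (auto simp: Suc_le_eq)
  finally show ?case .
qed simp

lemma inc_chain_iff_rank:
  assumes X: "partial_involution n X"
  shows "(\<exists>p q. inc_chain X k p q) \<longleftrightarrow> k \<le> rank X n n"
proof
  assume "\<exists>p q. inc_chain X k p q"
  then obtain p q where pq: "inc_chain X k p q" by blast
  then have "\<forall>a<k. p a < n \<and> q a < n"
    using partial_involution_less[OF X] partial_involution_less'[OF X]
    unfolding inc_chain_def by blast
  then show "k \<le> rank X n n" using inc_chain_length_le_rank[OF X pq] by blast
next
  assume "k \<le> rank X n n"
  then show "\<exists>p q. inc_chain X k p q" using inc_chain_upto_rank by blast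
qed

section \<open>Corners between points: decreasing chains and descents\<close>

lemma liveI:
  assumes "X i k" "k < j" "\<And>l. l < j \<Longrightarrow> \<not> shadow X i l"
  shows "live X i j"
  using assms by (auto simp: live_def)

lemma shadow_after:
  assumes X: "partial_involution n X" and "shadow X i l" "X i k"
  shows "k < l"
  using shadowE[OF X assms(2)] partial_involution_unique[OF X assms(3)] by metis

lemma shadow_unique:
  assumes X: "partial_involution n X" and "shadow X i l" "shadow X i k"
  shows "k = l"
  using partial_involution_unique[OF partial_involution_shadow[OF X]] assms by metis

text \<open>
  Otherwise the vertical line through \<open>(s', t')\<close> and the horizontal line through \<open>(s, t)\<close> would both
  reach \<open>(s', t)\<close> and form a corner there.
\<close>

lemma shadow_between:
  assumes X: "partial_involution n X" and st: "s < s'" "t' < t" and Xs: "X s t" "X s' t'"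
  shows "\<exists>u v. shadow X u v \<and> s < u \<and> u \<le> s' \<and> t' < v \<and> v \<le> t"
proof (rule ccontr)
  assume "\<not> ?thesis"
  then have none: "\<not> shadow X u v" if "s < u" "u \<le> s'" "t' < v" "v \<le> t" for u v
    using that by blast
  note sym = partial_involution_sym[OF X] partial_involution_sym[OF partial_involution_shadow[OF X]]
  have "live X s' t"
  proof (rule liveI[of X _ t'])
    show "\<not> shadow X s' l" if "l < t" for l
      using shadow_after[OF X _ Xs(2), of l] none[of s' l] st that by auto
  qed (use st Xs in auto)
  moreover have "live X t s'"
  proof (rule liveI[of X _ s])
    show "\<not> shadow X t l" if "l < s'" for l
      using shadow_after[OF X _ sym(1)[OF Xs(1)], of l] none[of l t] sym(2)[of t l] st that by auto
  qed (use st sym(1)[OF Xs(1)] in auto)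
  ultimately have "shadow X s' t" using shadow_iff_live[OF X] by blast
  then show False using none[of s' t] st by simp
qed

text \<open>Otherwise the point below \<open>(s, t)\<close> lies below row \<open>t'\<close> and the
  point to the left of \<open>(s', t')\<close> lies to the left of column \<open>s\<close>. Their
  lines would meet at \<open>(s, t')\<close>, giving column \<open>s\<close> a second
  corner.\<close>

lemma between_shadows:
  assumes X: "partial_involution n X" and st: "s < s'" "t' < t"
    and sh: "shadow X s t" "shadow X s' t'"
  shows "\<exists>u v. X u v \<and> s \<le> u \<and> u < s' \<and> t' \<le> v \<and> v < t"
proof (rule ccontr)
  assume "\<not> ?thesis"
  then have none: "\<not> X u v" if "s \<le> u" "u < s'" "t' \<le> v" "v < t" for u v
    using that by blast
  note sym = partial_involution_sym[OF X] partial_involution_sym[OF partial_involution_shadow[OF X]]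
  obtain v where v: "v < t" "X s v" using shadowE[OF X sh(1)] .
  obtain u where u: "u < s'" "X t' u" using shadowE[OF X sym(2)[OF sh(2)]] .
  have "v < t'" using none[of s v] v st by (meson le_refl not_le)
  moreover have "u < s" using none[of u t'] sym(1)[OF u(2)] u(1) st by (meson le_refl not_le)
  moreover have "\<not> shadow X s l" if "l < t'" for l
    using shadow_unique[OF X sh(1), of l] that st by auto
  moreover have "\<not> shadow X t' l" if "l < s" for l
    using shadow_unique[OF X sym(2)[OF sh(2)], of l] that st by auto
  ultimately have "live X s t'" "live X t' s"
    using liveI[of X s v t'] liveI[of X t' u s] v(2) u(2) by blast+
  then have "shadow X s t'" using shadow_iff_live[OF X] by blast
  then show False using shadow_unique[OF X sh(1)] st by fastforce
qed

text \<open>Points and corners interleave along a decreasing chain, so passing to the shadow costs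
  exactly one element.\<close>

lemma dec_chain_shadow:
  assumes X: "partial_involution n X"
  shows "(\<exists>p q. dec_chain X (Suc (Suc k)) p q) \<longleftrightarrow> (\<exists>p q. dec_chain (shadow X) (Suc k) p q)"
proof
  assume "\<exists>p q. dec_chain X (Suc (Suc k)) p q"
  then obtain p q where pq: "dec_chain X (Suc (Suc k)) p q" by blast
  have "\<exists>u v. shadow X u v \<and> p a < u \<and> u \<le> p (Suc a) \<and> q (Suc a) < v \<and> v \<le> q a"
    if "a < Suc k" for a
    using that pq by (intro shadow_between[OF X]) (auto simp: dec_chain_def)
  then obtain u v where uv: "\<And>a. a < Suc k \<Longrightarrow>
      shadow X (u a) (v a) \<and> p a < u a \<and> u a \<le> p (Suc a) \<and> q (Suc a) < v a \<and> v a \<le> q a"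
    by metis
  have le: "p (Suc a) \<le> p b \<and> q b \<le> q (Suc a)" if "b < Suc k" "a < b" for a b
    using that pq by (cases "b = Suc a") (auto simp: dec_chain_def less_imp_le)
  have "dec_chain (shadow X) (Suc k) u v"
    unfolding dec_chain_def
  proof (intro conjI allI impI)
    fix a b assume ab: "b < Suc k" "a < b"
    show "u a < u b" "v b < v a"
      using uv[of a] uv[of b] le[OF ab] ab by linarith+
  qed (use uv in blast)
  then show "\<exists>p q. dec_chain (shadow X) (Suc k) p q" by blast
next
  assume "\<exists>p q. dec_chain (shadow X) (Suc k) p q"
  then obtain p q where pq: "dec_chain (shadow X) (Suc k) p q" by blast
  then have sh: "shadow X (p a) (q a)" if "a \<le> k" for a
    using that by (auto simp: dec_chain_def)
  note sym = partial_involution_sym[OF X] partial_involution_sym[OF partial_involution_shadow[OF X]]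
  \<comment> \<open>Consecutive corners enclose a point. The two extra points start the horizontal
    line of the first corner and the vertical line of the last one.\<close>
  have "\<exists>u v. X u v \<and> (0 < a \<longrightarrow> p (a - 1) \<le> u \<and> v < q (a - 1)) \<and> (a \<le> k \<longrightarrow> u < p a \<and> q a \<le> v)"
    if a: "a < Suc (Suc k)" for a
  proof -
    consider "a = 0" | "a = Suc k" | b where "a = Suc b" "b < k" using a by (cases a; cases "a = Suc k") auto
    then show ?thesis
    proof cases
      case 1
      obtain u where "u < p 0" "X (q 0) u" using shadowE[OF X sym(2)[OF sh[of 0]]] by auto
      then show ?thesis using 1 sym(1) by blast
    next
      case 2
      obtain v where "v < q k" "X (p k) v" using shadowE[OF X sh[of k]] by auto
      then show ?thesis using 2 by auto
    next
      case 3
      have "\<exists>u v. X u v \<and> p b \<le> u \<and> u < p a \<and> q a \<le> v \<and> v < q b"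
        using 3 pq by (intro between_shadows[OF X]) (auto simp: dec_chain_def)
      then show ?thesis using 3 by auto
    qed
  qed
  then obtain u v where uv: "\<And>a. a < Suc (Suc k) \<Longrightarrow> X (u a) (v a) \<and>
      (0 < a \<longrightarrow> p (a - 1) \<le> u a \<and> v a < q (a - 1)) \<and> (a \<le> k \<longrightarrow> u a < p a \<and> q a \<le> v a)"
    by metis
  have le: "p a \<le> p (b - 1) \<and> q (b - 1) \<le> q a" if "b < Suc (Suc k)" "a < b" for a b
    using that pq by (cases "a = b - 1") (auto simp: dec_chain_def less_imp_le)
  have "dec_chain X (Suc (Suc k)) u v"
    unfolding dec_chain_def
  proof (intro conjI allI impI)
    fix a b assume ab: "b < Suc (Suc k)" "a < b"
    show "u a < u b" "v b < v a"
      using uv[of a] uv[of b] le[OF ab] ab by linarith+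
  qed (use uv in blast)
  then show "\<exists>p q. dec_chain X (Suc (Suc k)) p q" by blast
qed

text \<open>Otherwise the line of column \<open>i\<close> is still live in row \<open>m\<close>. The
  horizontal line that reaches column \<open>Suc i\<close> in row \<open>m\<close> has come through
  column \<open>i\<close>, where it would have met that line and been turned away.\<close>

lemma ascent_shadow:
  assumes X: "partial_involution n X" and asc: "X i j" "X (Suc i) j'" "j < j'"
    and sh: "shadow X (Suc i) m"
  shows "\<exists>l<m. shadow X i l"
proof (rule ccontr)
  assume none: "\<not> ?thesis"
  have less: "j' < m" using shadow_after[OF X sh asc(2)] .
  then have "live X i m" using none asc by (intro liveI[of X i j m, OF asc(1)]) auto
  moreover have "live X m (Suc i)" using sh shadow_iff_live[OF X] by blast
  moreover have "\<not> X m i"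
    using partial_involution_sym[OF X, of m i] partial_involution_unique[OF X asc(1), of m] less asc(3)
    by linarith
  ultimately have "live X m i"
    by (auto simp: live_def less_Suc_eq)
  then have "shadow X i m" using \<open>live X i m\<close> shadow_iff_live[OF X] by blast
  then have "shadow X m i" using partial_involution_sym[OF partial_involution_shadow[OF X]] by blast
  then show False using \<open>live X m (Suc i)\<close> by (auto simp: live_def)
qed

text \<open>The horizontal line that starts at \<open>(i, j)\<close> runs into column
  \<open>Suc i\<close>, whose own line has started lower down: they form a corner in row
  \<open>j\<close> unless that line was turned earlier.\<close>

lemma descent_shadow:
  assumes X: "partial_involution n X" and desc: "X i j" "X (Suc i) j'" "j' < j"
  shows "\<exists>m\<le>j. shadow X (Suc i) m"
proof (rule ccontr)
  assume none: "\<not> ?thesis"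
  have ji: "X j i" using partial_involution_sym[OF X desc(1)] .
  have "live X (Suc i) j" using none desc by (intro liveI[of X "Suc i" j', OF desc(2)]) auto
  moreover have "live X j (Suc i)"
  proof (rule liveI[of X j i, OF ji])
    show "\<not> shadow X j l" if "l < Suc i" for l
      using shadow_after[OF X _ ji, of l] that by auto
  qed simp
  ultimately have "shadow X (Suc i) j" using shadow_iff_live[OF X] by blast
  then show False using none by blast
qed

section \<open>Lattice words\<close>

text \<open>The entries of the tableau in row \<open>r\<close> and all later rows; row
  \<open>r\<close> itself is \<open>layer X r - layer X (Suc r)\<close>.\<close>

definition layer :: "(nat \<Rightarrow> nat \<Rightarrow> bool) \<Rightarrow> nat \<Rightarrow> nat set" where
  "layer X r = support ((shadow ^^ r) X)"

text \<open>
  \<open>word X i\<close> is the row, counted from 0, that contains \<open>i\<close> in the standard tableau of \<open>X\<close>, so that \<open>word X\<close> is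
  the Yamanouchi word of this tableau.
\<close>

definition word :: "(nat \<Rightarrow> nat \<Rightarrow> bool) \<Rightarrow> nat \<Rightarrow> nat" where
  "word X i = card {r. i \<in> layer X (Suc r)}"

definition row_count :: "nat set \<Rightarrow> (nat \<Rightarrow> nat) \<Rightarrow> nat \<Rightarrow> nat \<Rightarrow> nat" where
  "row_count A w r i = card {j \<in> A. j < i \<and> w j = r}"

text \<open>The inequality on prefixes says that the columns of the tableau increase. The value 0
  off \<open>A\<close> gives each word a single representing function, so that words can be
  counted.\<close>

definition lattice_words :: "nat set \<Rightarrow> (nat \<Rightarrow> nat) set" where
  "lattice_words A =
     {w. (\<forall>i. i \<notin> A \<longrightarrow> w i = 0) \<and> (\<forall>i r. row_count A w (Suc r) i \<le> row_count A w r i)}"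

text \<open>The column of \<open>i\<close>: the word of the transposed tableau.\<close>

definition conjugate :: "nat set \<Rightarrow> (nat \<Rightarrow> nat) \<Rightarrow> nat \<Rightarrow> nat" where
  "conjugate A w i = (if i \<in> A then row_count A w (w i) i else 0)"

section \<open>Layers and the rows of the tableau\<close>

lemma partial_involution_funpow_shadow:
  "partial_involution n X \<Longrightarrow> partial_involution n ((shadow ^^ r) X)"
  by (induction r) (simp_all add: partial_involution_shadow)

lemma layer_0 [simp]: "layer X 0 = support X"
  by (simp add: layer_def)

lemma layer_shadow: "layer (shadow X) r = layer X (Suc r)"
  by (simp add: layer_def funpow_swap1)

lemma layer_Suc_subset:
  assumes "partial_involution n X"
  shows "layer X (Suc r) \<subseteq> layer X r"
  using support_shadow_subset[OF partial_involution_funpow_shadow[OF assms, of r]]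
  by (simp add: layer_def)

lemma layer_antimono:
  assumes "partial_involution n X" and "r \<le> s"
  shows "layer X s \<subseteq> layer X r"
  using assms(2) layer_Suc_subset[OF assms(1)] by (rule lift_Suc_antimono_le[rotated])

lemma layer_empty:
  assumes X: "partial_involution n X"
  shows "layer X n = {}"
proof -
  have "layer X r \<subseteq> {r..}" for r
  proof (induction r)
    case (Suc r)
    then show ?case
      using support_shadow_greater[OF partial_involution_funpow_shadow[OF X, of r], of r]
      by (simp add: layer_def)
  qed simp
  moreover have "layer X n \<subseteq> {..<n}"
    using partial_involution_less[OF partial_involution_funpow_shadow[OF X, of n]]
    unfolding layer_def support_def by blast
  ultimately show ?thesis by fastforce
qed

text \<open>The layers are nested and finally empty, so the numbers counted by \<open>word\<close>
  form an initial segment, whose cardinality is its upper end.\<close>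

lemma less_word_iff:
  assumes X: "partial_involution n X"
  shows "r < word X i \<longleftrightarrow> i \<in> layer X (Suc r)"
proof -
  define m where "m = (LEAST r. i \<notin> layer X (Suc r))"
  have "i \<notin> layer X (Suc n)"
    using layer_empty[OF X] layer_Suc_subset[OF X, of n] by blast
  then have m: "i \<notin> layer X (Suc m)" unfolding m_def by (rule LeastI)
  have iff: "i \<in> layer X (Suc r) \<longleftrightarrow> r < m" for r
  proof
    assume "i \<in> layer X (Suc r)"
    then show "r < m" using m layer_antimono[OF X, of "Suc m" "Suc r"] by (meson Suc_le_mono not_le subsetD)
  next
    assume "r < m"
    then show "i \<in> layer X (Suc r)" unfolding m_def using not_less_Least by blast
  qed
  have "word X i = m"
    unfolding word_def iff by simp
  then show ?thesis using iff by simp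
qed

lemma le_word_iff:
  assumes "partial_involution n X" and "i \<in> support X"
  shows "r \<le> word X i \<longleftrightarrow> i \<in> layer X r"
  using assms(2) less_word_iff[OF assms(1)] by (cases r) (simp_all add: Suc_le_eq)

text \<open>Row \<open>r\<close> is the first row of the \<open>r\<close>-th shadow, whose entries
  are counted by \<open>rank_margin\<close>. Prefix counts of the word thus become ranks.\<close>

lemma row_count_word:
  assumes X: "partial_involution n X"
  shows "row_count (support X) (word X) r i = rank ((shadow ^^ r) X) i n"
proof -
  have "{j \<in> support X. j < i \<and> word X j = r} = (layer X r - layer X (Suc r)) \<inter> {..<i}"
  proof (rule set_eqI)
    fix j
    have "layer X r \<subseteq> support X" using layer_antimono[OF X, of 0 r] by simp
    then show "j \<in> {j \<in> support X. j < i \<and> word X j = r} \<longleftrightarrow> j \<in> (layer X r - layer X (Suc r)) \<inter> {..<i}"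
      using le_word_iff[OF X, of j r] le_word_iff[OF X, of j "Suc r"] by auto
  qed
  then show ?thesis
    using rank_margin[OF partial_involution_funpow_shadow[OF X, of r], of i]
    by (simp add: row_count_def layer_def)
qed

lemma word_in_lattice_words:
  assumes X: "partial_involution n X"
  shows "word X \<in> lattice_words (support X)"
  unfolding lattice_words_def
proof (intro CollectI conjI allI impI)
  fix i r
  show "word X i = 0" if "i \<notin> support X"
    using that less_word_iff[OF X, of 0 i] layer_antimono[OF X, of 0 "Suc 0"] by auto
  show "row_count (support X) (word X) (Suc r) i \<le> row_count (support X) (word X) r i"
    using rank_shadow_le[OF partial_involution_funpow_shadow[OF X, of r]]
    by (simp add: row_count_word[OF X])
qed

section \<open>The bijection between partial involutions and lattice words\<close>

lemma partial_involution_empty_support: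
  "support X = {} \<Longrightarrow> X = (\<lambda>_ _. False)"
  by (auto simp: support_def fun_eq_iff)

lemma word_inject:
  assumes X: "partial_involution n X" and X': "partial_involution n X'"
    and supp: "support X = support X'" and word: "word X = word X'"
  shows "X = X'"
proof -
  have layer: "layer X r = layer X' r" for r
    using supp less_word_iff[OF X] less_word_iff[OF X'] word by (cases r) auto
  \<comment> \<open>Backwards from the \<open>n\<close>-th shadow, which is empty: each shadow is
    determined by its support and the next one.\<close>
  have "(shadow ^^ (n - d)) X = (shadow ^^ (n - d)) X'" if "d \<le> n" for d
    using that
  proof (induction d)
    case 0
    show ?case
      using layer_empty[OF X] layer_empty[OF X']
        partial_involution_empty_support[of "(shadow ^^ n) X"]
        partial_involution_empty_support[of "(shadow ^^ n) X'"]
      by (simp add: layer_def)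
  next
    case (Suc d)
    then have "n - d = Suc (n - Suc d)" by simp
    then show ?case
      using Suc partial_involution_eqI[OF partial_involution_funpow_shadow[OF X, of "n - Suc d"]
          partial_involution_funpow_shadow[OF X', of "n - Suc d"]] layer[of "n - Suc d"]
      by (simp add: layer_def)
  qed
  from this[of n] show ?thesis by simp
qed

text \<open>Built from the last row upwards: once \<open>Y\<close> realises the layers from 1 on,
  \<open>partial_involution_exists\<close> adds the first row \<open>D 0 - D 1\<close>.\<close>

lemma partial_involution_with_layers:
  assumes "\<And>r. N \<le> r \<Longrightarrow> D r = {}" and "\<And>r. D (Suc r) \<subseteq> D r" and "D 0 \<subseteq> {..<n}"
    and "\<And>r i. card ((D (Suc r) - D (Suc (Suc r))) \<inter> {..<i}) \<le> card ((D r - D (Suc r)) \<inter> {..<i})"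
  shows "\<exists>X. partial_involution n X \<and> (\<forall>r. layer X r = D r)"
  using assms
proof (induction N arbitrary: D)
  case 0
  let ?X = "\<lambda>_ _. False"
  have X: "partial_involution n ?X" by (simp add: partial_involution_def)
  have "layer ?X r = D r" for r
    using layer_antimono[OF X, of 0 r] 0(1)[of r] by (simp add: support_def)
  then show ?case using X by blast
next
  case (Suc N)
  have "\<exists>Y. partial_involution n Y \<and> (\<forall>r. layer Y r = D (Suc r))"
    by (rule Suc.IH) (use Suc.prems(2)[of 0] Suc.prems in auto)
  then obtain Y where Y: "partial_involution n Y" and layer_Y: "\<And>r. layer Y r = D (Suc r)"
    by blast
  have supp_Y: "support Y = D 1" "support (shadow Y) = D 2"
    using layer_Y[of 0] layer_Y[of 1] by (simp_all add: layer_def numeral_2_eq_2)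
  obtain X where X: "partial_involution n X" "support X = (D 0 - D 1) \<union> support Y" "shadow X = Y"
  proof (rule partial_involution_exists[OF Y, of "D 0 - D 1"])
    show "rank Y i n \<le> card ((D 0 - D 1) \<inter> {..<i})" for i
      using Suc.prems(4)[of 0 i] rank_margin[OF Y, of i] supp_Y by (simp add: numeral_2_eq_2)
  qed (use Suc.prems(3) supp_Y in auto)
  have "layer X r = D r" for r
  proof (cases r)
    case 0
    then show ?thesis using X(2) supp_Y Suc.prems(2)[of 0] by auto
  next
    case (Suc m)
    then show ?thesis using layer_Y[of m] X(3) layer_shadow[of X m] by simp
  qed
  then show ?case using X(1) by blast
qed

lemma word_surj:
  assumes w: "w \<in> lattice_words A" and A: "A \<subseteq> {..<n}"
  shows "\<exists>X. partial_involution n X \<and> support X = A \<and> word X = w"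
proof -
  define D where "D r = {i \<in> A. r \<le> w i}" for r
  have "finite A" using A finite_subset by blast
  then have "finite (w ` A)" by simp
  then obtain N where N: "\<And>i. i \<in> A \<Longrightarrow> w i < N"
    unfolding finite_nat_set_iff_bounded by blast
  have Diff: "(D r - D (Suc r)) \<inter> {..<i} = {j \<in> A. j < i \<and> w j = r}" for r i
    by (auto simp: D_def)
  have "\<exists>X. partial_involution n X \<and> (\<forall>r. layer X r = D r)"
  proof (rule partial_involution_with_layers)
    show "D r = {}" if "N \<le> r" for r using that N by (fastforce simp: D_def)
    show "card ((D (Suc r) - D (Suc (Suc r))) \<inter> {..<i}) \<le> card ((D r - D (Suc r)) \<inter> {..<i})" for r i
      using w unfolding Diff by (simp add: lattice_words_def row_count_def)
  qed (use A in \<open>auto simp: D_def\<close>)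
  then obtain X where X: "partial_involution n X" and layer: "\<And>r. layer X r = D r" by blast
  have "word X i = w i" for i
  proof -
    have "{r. i \<in> layer X (Suc r)} = {..<w i}"
      using w by (auto simp: layer D_def lattice_words_def)
    then show ?thesis by (simp add: word_def)
  qed
  moreover have "support X = A" using layer[of 0] by (simp add: D_def)
  ultimately show ?thesis using X by blast
qed

lemma bij_betw_word:
  assumes "A \<subseteq> {..<n}"
  shows "bij_betw word {X. partial_involution n X \<and> support X = A} (lattice_words A)"
  unfolding bij_betw_def
proof
  show "inj_on word {X. partial_involution n X \<and> support X = A}"
    by (rule inj_onI) (use word_inject in blast)
  show "word ` {X. partial_involution n X \<and> support X = A} = lattice_words A"
    using word_in_lattice_words word_surj[OF _ assms] by fast
qed

text \<open>By \<open>ascent_shadow\<close> the ascent survives in every layer that contains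
  \<open>Suc i\<close>, so \<open>i\<close> belongs to each such layer.\<close>

lemma word_ascent:
  assumes X: "partial_involution n X" and asc: "X i j" "X (Suc i) j'" "j < j'"
  shows "word X (Suc i) \<le> word X i"
proof -
  have *: "\<exists>k k'. (shadow ^^ r) X i k \<and> (shadow ^^ r) X (Suc i) k' \<and> k < k'"
    if "Suc i \<in> layer X r" for r
    using that
  proof (induction r)
    case 0
    then show ?case using asc by auto
  next
    case (Suc r)
    let ?Y = "(shadow ^^ r) X"
    have Y: "partial_involution n ?Y" using partial_involution_funpow_shadow[OF X] .
    from Suc.prems have "Suc i \<in> layer X r" using layer_Suc_subset[OF X, of r] by blast
    then obtain k k' where k: "?Y i k" "?Y (Suc i) k'" "k < k'" using Suc.IH by blast
    from Suc.prems obtain m where m: "shadow ?Y (Suc i) m" by (auto simp: layer_def support_def)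
    then show ?case using ascent_shadow[OF Y k m] by auto
  qed
  have "r < word X i" if "r < word X (Suc i)" for r
    using that *[of "Suc r"] unfolding less_word_iff[OF X] by (auto simp: layer_def support_def)
  then show ?thesis by (meson not_le order_less_irrefl)
qed

text \<open>The descent survives in every layer that contains \<open>i\<close>: there the corner of
  column \<open>i\<close> lies above its point, that of column \<open>Suc i\<close> at or below this
  height.\<close>

lemma word_descent:
  assumes X: "partial_involution n X" and desc: "X i j" "X (Suc i) j'" "j' < j"
  shows "word X i < word X (Suc i)"
proof -
  have *: "\<exists>k k'. (shadow ^^ r) X i k \<and> (shadow ^^ r) X (Suc i) k' \<and> k' < k"
    if "i \<in> layer X r" for r
    using that
  proof (induction r)
    case 0
    then show ?case using desc by auto
  next
    case (Suc r)
    let ?Y = "(shadow ^^ r) X"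
    have Y: "partial_involution n ?Y" using partial_involution_funpow_shadow[OF X] .
    from Suc.prems have "i \<in> layer X r" using layer_Suc_subset[OF X, of r] by blast
    then obtain k k' where k: "?Y i k" "?Y (Suc i) k'" "k' < k" using Suc.IH by blast
    from Suc.prems obtain m where m: "shadow ?Y i m" by (auto simp: layer_def support_def)
    then have "k < m" using shadow_after[OF Y m k(1)] by simp
    then show ?case using descent_shadow[OF Y k] m by (auto intro: le_less_trans)
  qed
  have "i \<in> support X" using desc(1) by (auto simp: support_def)
  then have "i \<in> layer X (word X i)" using le_word_iff[OF X] by blast
  then obtain k k' where k: "(shadow ^^ word X i) X i k" "(shadow ^^ word X i) X (Suc i) k'" "k' < k"
    using * by blast
  \<comment> \<open>In the last layer containing \<open>i\<close> the descent still produces a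
    corner in column \<open>Suc i\<close>, which puts \<open>Suc i\<close> one layer deeper.\<close>
  have "Suc i \<in> layer X (Suc (word X i))"
    using descent_shadow[OF partial_involution_funpow_shadow[OF X] k] by (auto simp: layer_def support_def)
  then show ?thesis unfolding less_word_iff[OF X] .
qed

lemma inc_chain_iff_word:
  assumes "partial_involution n X"
  shows "(\<exists>p q. inc_chain X (Suc k) p q) \<longleftrightarrow> k < row_count (support X) (word X) 0 n"
  using inc_chain_iff_rank[OF assms, of "Suc k"] row_count_word[OF assms, of 0 n] by auto

text \<open>Each shadow takes one element off a decreasing chain; after \<open>k\<close> of them a
  single point remains to be found.\<close>

lemma dec_chain_iff_layer:
  assumes "partial_involution n X"
  shows "(\<exists>p q. dec_chain X (Suc k) p q) \<longleftrightarrow> layer X k \<noteq> {}"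
  using assms
proof (induction k arbitrary: X)
  case 0
  show ?case by (auto simp: dec_chain_def support_def)
next
  case (Suc k)
  then show ?case
    using dec_chain_shadow[OF Suc.prems] Suc.IH[OF partial_involution_shadow[OF Suc.prems]]
    by (simp add: layer_shadow)
qed

lemma dec_chain_iff_word:
  assumes X: "partial_involution n X"
  shows "(\<exists>p q. dec_chain X (Suc k) p q) \<longleftrightarrow> (\<exists>i\<in>support X. k \<le> word X i)"
  using dec_chain_iff_layer[OF X] le_word_iff[OF X] layer_antimono[OF X, of 0 k] by auto

section \<open>Transposition\<close>

lemma row_count_Suc:
  assumes "finite A"
  shows "row_count A w r (Suc i) = row_count A w r i + of_bool (i \<in> A \<and> w i = r)"
proof -
  have "{j \<in> A. j < Suc i \<and> w j = r} =
      (if i \<in> A \<and> w i = r then insert i {j \<in> A. j < i \<and> w j = r} else {j \<in> A. j < i \<and> w j = r})"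
    by (auto simp: less_Suc_eq)
  then show ?thesis using assms by (simp add: row_count_def)
qed

lemma row_count_mono:
  assumes "finite A" and "i \<le> j"
  shows "row_count A w r i \<le> row_count A w r j"
  unfolding row_count_def by (rule card_mono) (use assms in auto)

lemma row_count_antimono:
  assumes "w \<in> lattice_words A" and "r \<le> s"
  shows "row_count A w s i \<le> row_count A w r i"
proof (rule lift_Suc_antimono_le[of "\<lambda>r. row_count A w r i"])
  show "row_count A w (Suc r) i \<le> row_count A w r i" for r
    using assms(1) by (simp add: lattice_words_def)
qed (rule assms(2))

lemma finite_long_rows:
  assumes "finite A"
  shows "finite {r. c < row_count A w r i}"
proof (rule finite_subset)
  show "{r. c < row_count A w r i} \<subseteq> w ` A"
  proof
    fix r assume "r \<in> {r. c < row_count A w r i}"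
    then have "0 < card {j \<in> A. j < i \<and> w j = r}"
      by (simp add: row_count_def)
    then have "{j \<in> A. j < i \<and> w j = r} \<noteq> {}" unfolding card_gt_0_iff by blast
    then show "r \<in> w ` A" by auto
  qed
qed (use assms in simp)

text \<open>Column \<open>c\<close> has one entry for each row longer than \<open>c\<close>. When
  \<open>i\<close> is appended, its row passes length \<open>c\<close> exactly if \<open>c\<close>
  was its previous length, which is the column given to \<open>i\<close>.\<close>

lemma row_count_conjugate:
  assumes "finite A"
  shows "row_count A (conjugate A w) c i = card {r. c < row_count A w r i}"
proof (induction i)
  case 0
  show ?case by (simp add: row_count_def)
next
  case (Suc i)
  have "{r. c < row_count A w r (Suc i)} =
      (if i \<in> A \<and> row_count A w (w i) i = c then insert (w i) {r. c < row_count A w r i}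
       else {r. c < row_count A w r i})"
    by (auto simp: row_count_Suc[OF assms] less_Suc_eq)
  then show ?case
    using Suc finite_long_rows[OF assms, of c w i]
    by (simp add: row_count_Suc[OF assms] conjugate_def)
qed

lemma conjugate_in_lattice_words:
  assumes "finite A"
  shows "conjugate A w \<in> lattice_words A"
  unfolding lattice_words_def
proof (intro CollectI conjI allI impI)
  fix i c
  show "conjugate A w i = 0" if "i \<notin> A"
    using that by (simp add: conjugate_def)
  show "row_count A (conjugate A w) (Suc c) i \<le> row_count A (conjugate A w) c i"
    unfolding row_count_conjugate[OF assms]
    by (rule card_mono) (use finite_long_rows[OF assms] in auto)
qed

lemma conjugate_conjugate:
  assumes A: "finite A" and w: "w \<in> lattice_words A"
  shows "conjugate A (conjugate A w) = w"
proof
  fix i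
  show "conjugate A (conjugate A w) i = w i"
  proof (cases "i \<in> A")
    case True
    \<comment> \<open>Before \<open>i\<close> is placed, later rows are not longer than its row;
      after it is placed, earlier rows are at least as long. So the strictly longer rows are those
      preceding \<open>w i\<close>.\<close>
    have "row_count A w (w i) i < row_count A w r i \<longleftrightarrow> r < w i" for r
    proof
      assume "row_count A w (w i) i < row_count A w r i"
      then show "r < w i" using row_count_antimono[OF w, of "w i" r i] by (meson leD not_le)
    next
      assume "r < w i"
      then have "row_count A w (w i) (Suc i) \<le> row_count A w r i"
        using row_count_antimono[OF w, of r "w i" "Suc i"] row_count_Suc[OF A, of w r i] by simp
      then show "row_count A w (w i) i < row_count A w r i"
        using True by (simp add: row_count_Suc[OF A])
    qed
    then have "{r. row_count A w (w i) i < row_count A w r i} = {..<w i}" by auto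
    then show ?thesis
      using True by (simp add: conjugate_def[of A "conjugate A w"] row_count_conjugate[OF A])
        (simp add: conjugate_def)
  next
    case False
    then show ?thesis using w by (simp add: conjugate_def lattice_words_def)
  qed
qed

text \<open>If \<open>Suc i\<close> is in the row of \<open>i\<close> or an earlier one, that row is
  already as long as the row ending in \<open>i\<close>, so \<open>Suc i\<close> lands strictly to
  the right. A later row was no longer than that of \<open>i\<close> before \<open>i\<close> came,
  so there it lands weakly to the left.\<close>

lemma conjugate_descent_iff:
  assumes A: "finite A" and w: "w \<in> lattice_words A" and i: "i \<in> A" "Suc i \<in> A"
  shows "conjugate A w i < conjugate A w (Suc i) \<longleftrightarrow> w (Suc i) \<le> w i"
proof
  assume "w (Suc i) \<le> w i"
  then have "row_count A w (w i) (Suc i) \<le> row_count A w (w (Suc i)) (Suc i)"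
    by (rule row_count_antimono[OF w])
  then show "conjugate A w i < conjugate A w (Suc i)"
    using i by (simp add: conjugate_def row_count_Suc[OF A])
next
  assume "conjugate A w i < conjugate A w (Suc i)"
  then have less: "row_count A w (w i) i < row_count A w (w (Suc i)) (Suc i)"
    using i by (simp add: conjugate_def)
  show "w (Suc i) \<le> w i"
  proof (rule ccontr)
    assume "\<not> ?thesis"
    then show False
      using row_count_antimono[OF w, of "w i" "w (Suc i)" i] less
      by (simp add: row_count_Suc[OF A])
  qed
qed

text \<open>The first row is the longest one, so it alone decides whether column \<open>k\<close> is
  occupied.\<close>

lemma conjugate_bounded_iff:
  assumes A: "A \<subseteq> {..<n}" and w: "w \<in> lattice_words A"
  shows "(\<exists>i\<in>A. k \<le> conjugate A w i) \<longleftrightarrow> k < row_count A w 0 n"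
proof -
  have fin: "finite A" using A finite_subset by blast
  show ?thesis
  proof
    assume "\<exists>i\<in>A. k \<le> conjugate A w i"
    then obtain i where i: "i \<in> A" "k \<le> row_count A w (w i) i"
      by (auto simp: conjugate_def)
    then have "k < row_count A w (w i) (Suc i)" by (simp add: row_count_Suc[OF fin])
    also have "\<dots> \<le> row_count A w 0 (Suc i)" by (rule row_count_antimono[OF w]) simp
    also have "\<dots> \<le> row_count A w 0 n" by (rule row_count_mono[OF fin]) (use i A in auto)
    finally show "k < row_count A w 0 n" .
  next
    assume "k < row_count A w 0 n"
    then have "0 < card {r. k < row_count A w r n}"
      using finite_long_rows[OF fin, of k w n] by (auto simp: card_gt_0_iff)
    then have "0 < card {j \<in> A. j < n \<and> conjugate A w j = k}"
      unfolding row_count_conjugate[OF fin, symmetric] by (simp only: row_count_def)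
    then have "{j \<in> A. j < n \<and> conjugate A w j = k} \<noteq> {}" unfolding card_gt_0_iff by blast
    then show "\<exists>i\<in>A. k \<le> conjugate A w i" by auto
  qed
qed

section \<open>Involutions\<close>

definition involutions :: "nat \<Rightarrow> (nat \<Rightarrow> nat) set" where
  "involutions n = {p. p permutes {1..n} \<and> p = inv p}"

text \<open>Restricting to \<open>{1..n}\<close> drops the fixed points outside. Grids start at 0,
  so the graph lives in a grid of size \<open>Suc n\<close> whose column 0 is empty.\<close>

definition perm_graph :: "nat \<Rightarrow> (nat \<Rightarrow> nat) \<Rightarrow> nat \<Rightarrow> nat \<Rightarrow> bool" where
  "perm_graph n p i j \<longleftrightarrow> i \<in> {1..n} \<and> p i = j"

lemma involutions_iff:
  "p \<in> involutions n \<longleftrightarrow> p permutes {1..n} \<and> (\<forall>i. p (p i) = i)"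
proof
  assume "p \<in> involutions n"
  then have p: "p permutes {1..n}" "p = inv p" by (auto simp: involutions_def)
  then show "p permutes {1..n} \<and> (\<forall>i. p (p i) = i)"
    using permutes_inverses(2)[OF p(1)] p by simp
next
  assume p: "p permutes {1..n} \<and> (\<forall>i. p (p i) = i)"
  then have "inv p = p" by (intro inv_equality) auto
  then show "p \<in> involutions n" using p by (simp add: involutions_def)
qed

lemma involution_Suc_neq:
  assumes "p \<in> involutions n"
  shows "p i \<noteq> p (Suc i)"
proof -
  have "inj p" using assms permutes_inj unfolding involutions_iff by blast
  then show ?thesis by (simp add: inj_eq)
qed

lemma support_graph: "support (perm_graph n p) = {1..n}"
  by (auto simp: support_def perm_graph_def)

lemma partial_involution_graph:
  assumes "p \<in> involutions n"
  shows "partial_involution (Suc n) (perm_graph n p)"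
proof -
  have p: "p permutes {1..n}" "p (p i) = i" for i using assms by (auto simp: involutions_iff)
  have "perm_graph n p j i" if "perm_graph n p i j" for i j
    using that permutes_in_image[OF p(1), of i] p(2)[of i] unfolding perm_graph_def by metis
  then show ?thesis unfolding partial_involution_def by (auto simp: perm_graph_def)
qed

lemma bij_betw_perm_graph:
  "bij_betw (perm_graph n) (involutions n) {X. partial_involution (Suc n) X \<and> support X = {1..n}}"
  unfolding bij_betw_def
proof
  show "inj_on (perm_graph n) (involutions n)"
  proof (rule inj_onI)
    fix p q assume pq: "p \<in> involutions n" "q \<in> involutions n" and eq: "perm_graph n p = perm_graph n q"
    show "p = q"
    proof
      fix i
      show "p i = q i"
      proof (cases "i \<in> {1..n}")
        case True
        then show ?thesis using fun_cong[OF fun_cong[OF eq, of i], of "p i"] by (simp add: perm_graph_def)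
      next
        case False
        then show ?thesis
          using pq permutes_not_in[of p "{1..n}" i] permutes_not_in[of q "{1..n}" i]
          by (simp add: involutions_def)
      qed
    qed
  qed
  show "perm_graph n ` involutions n = {X. partial_involution (Suc n) X \<and> support X = {1..n}}"
  proof
    show "perm_graph n ` involutions n \<subseteq> {X. partial_involution (Suc n) X \<and> support X = {1..n}}"
      using partial_involution_graph support_graph by blast
  next
    show "{X. partial_involution (Suc n) X \<and> support X = {1..n}} \<subseteq> perm_graph n ` involutions n"
    proof
      fix X assume "X \<in> {X. partial_involution (Suc n) X \<and> support X = {1..n}}"
      then have X: "partial_involution (Suc n) X" and supp: "support X = {1..n}" by auto
      define p where "p i = (if i \<in> {1..n} then THE j. X i j else i)" for i
      have p_outside: "p i = i" if "i \<notin> {1..n}" for i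
        using that unfolding p_def by (rule if_not_P)
      have p_eq: "p i = j" if "X i j" for i j
      proof -
        have "i \<in> support X" using that by (auto simp: support_def)
        then show ?thesis
          using that partial_involution_unique[OF X] supp unfolding p_def by (auto intro: the_equality)
      qed
      have Xp: "X i (p i)" if i: "i \<in> {1..n}" for i
      proof -
        obtain j where "X i j" using i unfolding supp[symmetric] support_def by blast
        then show ?thesis using p_eq by blast
      qed
      have pp: "p (p i) = i" for i
      proof (cases "i \<in> {1..n}")
        case True
        then show ?thesis using p_eq partial_involution_sym[OF X] Xp by blast
      next
        case False
        show ?thesis by (simp only: p_outside[OF False])
      qed
      have "p permutes {1..n}"
        unfolding permutes_def
      proof (intro conjI allI impI)
        show "p i = i" if "i \<notin> {1..n}" for i using that by (rule p_outside)
        show "\<exists>!j. p j = i" for i using pp by metis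
      qed
      then have "p \<in> involutions n" using pp by (simp add: involutions_iff)
      moreover have "X = perm_graph n p"
      proof (intro ext)
        fix i j
        show "X i j = perm_graph n p i j"
        proof
          assume "X i j"
          moreover from this have "i \<in> {1..n}" using supp by (auto simp: support_def)
          ultimately show "perm_graph n p i j" using p_eq by (simp add: perm_graph_def)
        next
          assume "perm_graph n p i j"
          then show "X i j" using Xp by (auto simp: perm_graph_def)
        qed
      qed
      ultimately show "X \<in> perm_graph n ` involutions n" by blast
    qed
  qed
qed

lemma bij_betw_word_graph:
  "bij_betw (\<lambda>p. word (perm_graph n p)) (involutions n) (lattice_words {1..n})"
proof -
  have "{1..n} \<subseteq> {..<Suc n}" by auto
  from bij_betw_trans[OF bij_betw_perm_graph bij_betw_word[OF this]] show ?thesis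
    by (simp add: comp_def)
qed

lemma word_graph_descent_iff:
  assumes p: "p \<in> involutions n" and i: "i \<in> {1..<n}"
  shows "word (perm_graph n p) i < word (perm_graph n p) (Suc i) \<longleftrightarrow> p (Suc i) < p i"
proof -
  have inj: "p i \<noteq> p (Suc i)" by (rule involution_Suc_neq[OF p])
  have g: "perm_graph n p i (p i)" "perm_graph n p (Suc i) (p (Suc i))"
    using i by (auto simp: perm_graph_def)
  show ?thesis
    using word_ascent[OF partial_involution_graph[OF p] g]
      word_descent[OF partial_involution_graph[OF p] g] inj
    by linarith
qed

text \<open>Transposition for a prescribed descent set: \<open>Q\<close> is left arbitrary so that
  odd and even positions give the two equations of the theorem.\<close>

lemma card_involutions_conjugate:
  "card {p \<in> involutions n. (\<forall>i\<in>{1..<n}. p i < p (Suc i) \<longleftrightarrow> Q i)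
      \<and> \<not> (\<exists>f g. inc_chain (perm_graph n p) (Suc k) f g)} =
   card {p \<in> involutions n. (\<forall>i\<in>{1..<n}. p (Suc i) < p i \<longleftrightarrow> Q i)
      \<and> \<not> (\<exists>f g. dec_chain (perm_graph n p) (Suc k) f g)}"
  (is "card ?I = card ?D")
proof -
  let ?A = "{1..n}" and ?W = "\<lambda>p. word (perm_graph n p)"
  \<comment> \<open>\<open>P\<close> and \<open>P'\<close> express the two families through words:
    an ascent is a weak decrease of the word, a long increasing chain is a long first row, and a
    long decreasing chain is an entry in row \<open>k\<close> or later. Conjugation exchanges
    them.\<close>
  define P where "P w \<longleftrightarrow> (\<forall>i\<in>{1..<n}. w (Suc i) \<le> w i \<longleftrightarrow> Q i)
    \<and> \<not> k < row_count ?A w 0 (Suc n)" for w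
  define P' where "P' w \<longleftrightarrow> (\<forall>i\<in>{1..<n}. w i < w (Suc i) \<longleftrightarrow> Q i)
    \<and> \<not> (\<exists>i\<in>?A. k \<le> w i)" for w
  let ?L = "{w \<in> lattice_words ?A. P w}" and ?M = "{w \<in> lattice_words ?A. P' w}"
  have A: "?A \<subseteq> {..<Suc n}" "finite ?A" by auto
  have bij: "bij_betw ?W {p \<in> involutions n. P (?W p)} {w \<in> lattice_words ?A. P w}" for P
    by (rule bij_betw_Collect[OF bij_betw_word_graph]) simp
  have less: "p i < p (Suc i) \<longleftrightarrow> ?W p (Suc i) \<le> ?W p i" 
    if "p \<in> involutions n" "i \<in> {1..<n}" for p i
  proof -
    have "p i \<noteq> p (Suc i)" by (rule involution_Suc_neq[OF that(1)])
    then show ?thesis using word_graph_descent_iff[OF that] by linarith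
  qed
  have "?I = {p \<in> involutions n. P (?W p)}"
  proof (rule Collect_cong, rule conj_cong[OF refl])
    fix p assume p: "p \<in> involutions n"
    show "((\<forall>i\<in>{1..<n}. p i < p (Suc i) \<longleftrightarrow> Q i) \<and> \<not> (\<exists>f g. inc_chain (perm_graph n p) (Suc k) f g))
      \<longleftrightarrow> P (?W p)"
      unfolding P_def
      using less[OF p] inc_chain_iff_word[OF partial_involution_graph[OF p], unfolded support_graph]
      by simp
  qed
  then have "card ?I = card ?L" using bij_betw_same_card[OF bij[of P]] by (simp only:)
  also have "card ?L = card ?M"
  proof (rule bij_betw_same_card[of "conjugate ?A"],
      rule bij_betw_byWitness[of _ "conjugate ?A" "conjugate ?A"])
    show "\<forall>w\<in>?L. conjugate ?A (conjugate ?A w) = w" "\<forall>w\<in>?M. conjugate ?A (conjugate ?A w) = w"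
      using conjugate_conjugate[OF A(2)] by simp_all
    have P_iff: "P w \<longleftrightarrow> P' (conjugate ?A w)" if "w \<in> lattice_words ?A" for w
      unfolding P_def P'_def
      using conjugate_descent_iff[OF A(2) that] conjugate_bounded_iff[OF A(1) that] by simp
    then show "conjugate ?A ` ?L \<subseteq> ?M"
      using conjugate_in_lattice_words[OF A(2)] by auto
    show "conjugate ?A ` ?M \<subseteq> ?L"
    proof
      fix v assume "v \<in> conjugate ?A ` ?M"
      then obtain w where w: "w \<in> ?M" "v = conjugate ?A w" by blast
      then have "v \<in> lattice_words ?A" "conjugate ?A v = w"
        using conjugate_in_lattice_words[OF A(2)] conjugate_conjugate[OF A(2)] by simp_all
      then show "v \<in> ?L" using P_iff[of v] w(1) by simp
    qed
  qed
  also have "card ?M = card ?D"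
  proof -
    have "?D = {p \<in> involutions n. P' (?W p)}"
    proof (rule Collect_cong, rule conj_cong[OF refl])
      fix p assume p: "p \<in> involutions n"
      show "((\<forall>i\<in>{1..<n}. p (Suc i) < p i \<longleftrightarrow> Q i) \<and> \<not> (\<exists>f g. dec_chain (perm_graph n p) (Suc k) f g))
        \<longleftrightarrow> P' (?W p)"
        unfolding P'_def
        using word_graph_descent_iff[OF p]
          dec_chain_iff_word[OF partial_involution_graph[OF p], unfolded support_graph]
        by simp
    qed
    then show ?thesis using bij_betw_same_card[OF bij[of P']] by (simp only:)
  qed
  finally show ?thesis .
qed

section \<open>Monotone patterns as chains\<close>

lemma contains_increasing_pattern_iff:
  assumes "\<And>a b. a < length \<tau> \<Longrightarrow> b < length \<tau> \<Longrightarrow> \<tau> ! a < \<tau> ! b \<longleftrightarrow> a < b"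
  shows "contains_pattern n p \<tau> \<longleftrightarrow> (\<exists>f g. inc_chain (perm_graph n p) (length \<tau>) f g)"
proof
  assume "contains_pattern n p \<tau>"
  then obtain f where "strict_mono_on {..<length \<tau>} f" "f ` {..<length \<tau>} \<subseteq> {1..n}"
    "\<forall>a<length \<tau>. \<forall>b<length \<tau>. p (f a) < p (f b) \<longleftrightarrow> \<tau> ! a < \<tau> ! b"
    unfolding contains_pattern_def by blast
  then have "inc_chain (perm_graph n p) (length \<tau>) f (p \<circ> f)"
    using assms by (auto simp: inc_chain_def perm_graph_def strict_mono_on_def)
  then show "\<exists>f g. inc_chain (perm_graph n p) (length \<tau>) f g" by blast
next
  assume "\<exists>f g. inc_chain (perm_graph n p) (length \<tau>) f g"
  then obtain f g where fg: "inc_chain (perm_graph n p) (length \<tau>) f g" by blast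
  then have g: "p (f a) = g a" "f a \<in> {1..n}" if "a < length \<tau>" for a
    using that unfolding inc_chain_def perm_graph_def by blast+
  have less: "f a < f b" "g a < g b" if "b < length \<tau>" "a < b" for a b
    using fg that unfolding inc_chain_def by blast+
  have "p (f a) < p (f b) \<longleftrightarrow> a < b" if "a < length \<tau>" "b < length \<tau>" for a b
    using less(2)[of a b] less(2)[of b a] that unfolding g(1)[OF that(1)] g(1)[OF that(2)]
    by (cases a b rule: linorder_cases) simp_all
  then have "\<forall>a<length \<tau>. \<forall>b<length \<tau>. p (f a) < p (f b) \<longleftrightarrow> \<tau> ! a < \<tau> ! b"
    using assms by simp
  moreover have "strict_mono_on {..<length \<tau>} f"
    using less(1) by (simp add: strict_mono_on_def)
  moreover have "f ` {..<length \<tau>} \<subseteq> {1..n}" using g(2) by blast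
  ultimately show "contains_pattern n p \<tau>" unfolding contains_pattern_def by blast
qed

lemma contains_decreasing_pattern_iff:
  assumes "\<And>a b. a < length \<tau> \<Longrightarrow> b < length \<tau> \<Longrightarrow> \<tau> ! a < \<tau> ! b \<longleftrightarrow> b < a"
  shows "contains_pattern n p \<tau> \<longleftrightarrow> (\<exists>f g. dec_chain (perm_graph n p) (length \<tau>) f g)"
proof
  assume "contains_pattern n p \<tau>"
  then obtain f where "strict_mono_on {..<length \<tau>} f" "f ` {..<length \<tau>} \<subseteq> {1..n}"
    "\<forall>a<length \<tau>. \<forall>b<length \<tau>. p (f a) < p (f b) \<longleftrightarrow> \<tau> ! a < \<tau> ! b"
    unfolding contains_pattern_def by blast
  then have "dec_chain (perm_graph n p) (length \<tau>) f (p \<circ> f)"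
    using assms by (auto simp: dec_chain_def perm_graph_def strict_mono_on_def)
  then show "\<exists>f g. dec_chain (perm_graph n p) (length \<tau>) f g" by blast
next
  assume "\<exists>f g. dec_chain (perm_graph n p) (length \<tau>) f g"
  then obtain f g where fg: "dec_chain (perm_graph n p) (length \<tau>) f g" by blast
  then have g: "p (f a) = g a" "f a \<in> {1..n}" if "a < length \<tau>" for a
    using that unfolding dec_chain_def perm_graph_def by blast+
  have less: "f a < f b" "g b < g a" if "b < length \<tau>" "a < b" for a b
    using fg that unfolding dec_chain_def by blast+
  have "p (f a) < p (f b) \<longleftrightarrow> b < a" if "a < length \<tau>" "b < length \<tau>" for a b
    using less(2)[of a b] less(2)[of b a] that unfolding g(1)[OF that(1)] g(1)[OF that(2)]
    by (cases a b rule: linorder_cases) simp_all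
  then have "\<forall>a<length \<tau>. \<forall>b<length \<tau>. p (f a) < p (f b) \<longleftrightarrow> \<tau> ! a < \<tau> ! b"
    using assms by simp
  moreover have "strict_mono_on {..<length \<tau>} f"
    using less(1) by (simp add: strict_mono_on_def)
  moreover have "f ` {..<length \<tau>} \<subseteq> {1..n}" using g(2) by blast
  ultimately show "contains_pattern n p \<tau>" unfolding contains_pattern_def by blast
qed

lemma avoids_1234_iff:
  "avoids n p [1, 2, 3, 4] \<longleftrightarrow> \<not> (\<exists>f g. inc_chain (perm_graph n p) (Suc 3) f g)"
proof -
  have "[1, 2, 3, 4] ! a = Suc a" if "a < 4" for a :: nat
    using that by (auto simp: less_Suc_eq numeral_eq_Suc)
  then have "contains_pattern n p [1, 2, 3, 4] \<longleftrightarrow> (\<exists>f g. inc_chain (perm_graph n p) (length ([1, 2, 3, 4] :: nat list)) f g)"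
    by (intro contains_increasing_pattern_iff) simp
  moreover have "length ([1, 2, 3, 4] :: nat list) = Suc 3" by simp
  ultimately show ?thesis by (simp only: avoids_def)
qed

lemma avoids_4321_iff:
  "avoids n p [4, 3, 2, 1] \<longleftrightarrow> \<not> (\<exists>f g. dec_chain (perm_graph n p) (Suc 3) f g)"
proof -
  have "[4, 3, 2, 1] ! a = 4 - a" if "a < 4" for a :: nat
    using that by (auto simp: less_Suc_eq numeral_eq_Suc)
  then have "contains_pattern n p [4, 3, 2, 1] \<longleftrightarrow> (\<exists>f g. dec_chain (perm_graph n p) (length ([4, 3, 2, 1] :: nat list)) f g)"
    by (intro contains_decreasing_pattern_iff) auto
  moreover have "length ([4, 3, 2, 1] :: nat list) = Suc 3" by simp
  ultimately show ?thesis by (simp only: avoids_def)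
qed

theorem theorem5p5:
  fixes n :: nat
  assumes "n \<ge> 1"
  shows "card (AI_avoiding n [1, 2, 3, 4]) = card (RAI_avoiding n [4, 3, 2, 1]) \<and>
         card (RAI_avoiding n [1, 2, 3, 4]) = card (AI_avoiding n [4, 3, 2, 1])"
proof -
  have I: "AI n = {p \<in> involutions n. alternating n p}"
    "RAI n = {p \<in> involutions n. reverse_alternating n p}"
    by (auto simp: AI_def RAI_def involutions_def)
  \<comment> \<open>Consecutive values differ, so either kind of alternation can be stated by
    ascents or by descents, with odd and even exchanged. The first equation then takes
    \<open>Q\<close> to be \<open>odd\<close>, the second \<open>even\<close>.\<close>
  have less_iff: "p i < p (Suc i) \<longleftrightarrow> \<not> p (Suc i) < p i" if "p \<in> involutions n" for p i
    using involution_Suc_neq[OF that, of i] by linarith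
  have alternating: "alternating n p \<longleftrightarrow> (\<forall>i\<in>{1..<n}. p (Suc i) < p i \<longleftrightarrow> even i)"
    and reverse_alternating: "reverse_alternating n p \<longleftrightarrow> (\<forall>i\<in>{1..<n}. p i < p (Suc i) \<longleftrightarrow> even i)"
    if "p \<in> involutions n" for p
    using less_iff[OF that] by (auto simp: alternating_def reverse_alternating_def)
  have "AI_avoiding n [1, 2, 3, 4] =
      {p \<in> involutions n. (\<forall>i\<in>{1..<n}. p i < p (Suc i) \<longleftrightarrow> odd i)
        \<and> \<not> (\<exists>f g. inc_chain (perm_graph n p) (Suc 3) f g)}"
    unfolding AI_avoiding_def I avoids_1234_iff alternating_def Suc_eq_plus1[symmetric] by blast
  moreover have "RAI_avoiding n [4, 3, 2, 1] =
      {p \<in> involutions n. (\<forall>i\<in>{1..<n}. p (Suc i) < p i \<longleftrightarrow> odd i)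
        \<and> \<not> (\<exists>f g. dec_chain (perm_graph n p) (Suc 3) f g)}"
    unfolding RAI_avoiding_def I avoids_4321_iff reverse_alternating_def Suc_eq_plus1[symmetric] by blast
  moreover have "RAI_avoiding n [1, 2, 3, 4] =
      {p \<in> involutions n. (\<forall>i\<in>{1..<n}. p i < p (Suc i) \<longleftrightarrow> even i)
        \<and> \<not> (\<exists>f g. inc_chain (perm_graph n p) (Suc 3) f g)}"
    unfolding RAI_avoiding_def I avoids_1234_iff by (simp add: reverse_alternating cong: conj_cong)
  moreover have "AI_avoiding n [4, 3, 2, 1] =
      {p \<in> involutions n. (\<forall>i\<in>{1..<n}. p (Suc i) < p i \<longleftrightarrow> even i)
        \<and> \<not> (\<exists>f g. dec_chain (perm_graph n p) (Suc 3) f g)}"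
    unfolding AI_avoiding_def I avoids_4321_iff by (simp add: alternating cong: conj_cong)
  ultimately show ?thesis by (simp only: card_involutions_conjugate)
qed

end
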